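(* Let $\mathscr{E}$ be a quasi-potential multi-leader multi-follower game with associated functions $\phi_1,\dots,\phi_N$, $h$, $\pi$, and suppose $\varphi_i$ is a continuously differentiable function over $X\times Y$ for $i=1,\dots,N$. If $(x,w)$ is a B-stationary point of $$\mathrm{P}^{\rm quasi}:\qquad \min_{(x',w')}\ \pi(x')+h(x',w')\quad\text{subject to}\quad (x',w')\in\mathcal{F}^{\rm quasi},$$ then $(x,y)$, where $y=(y_1,\dots,y_N)$ with $y_i=w$ for all $i\in\mathcal{N}$, is a Nash B-stationary point of $\mathscr{E}$.
   Context: Multi-leader multi-follower game $\mathscr{E}$: $\mathcal{N}=\{1,\dots,N\}$ is the set of leaders. Leader $i$ has a convex compact strategy set $X_i\subseteq\mathbb{R}^{m_i}$; $X=\prod_{i=1}^N X_i$. For $x=(x_1,\dots,x_N)$, $x^{-i}$ denotes $(x_1,\dots,x_{i-1},x_{i+1},\dots,x_N)$ and $(\bar x_i,x^{-i})$ denotes $x$ with $i$-th component replaced by $\bar x_i$. $Y$ is the ambient Euclidean space of follower strategy profiles. For each $x\in X$, the set of follower equilibria is $\mathcal{S}(x)\subseteq Y$, the (possibly multivalued, possibly empty) solution set of the variational inequality $\mathrm{VI}(G(x,\cdot),K(x))$, i.e. $\mathcal{S}(x)=\{y\in K(x): G(x,y)^\top(z-y)\ge 0\ \ \forall z\in K(x)\}$, where $K$ is a continuous set-valued map with closed convex values in $Y$ and $G$ is a continuous map of all its variables. Leader $i$ has a continuous objective $\varphi_i$ on $X\times Y$, written $\varphi_i(x_i,y_i;x^{-i})$,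 and (optimistic formulation) solves $$\mathrm{L}_i(x^{-i}):\quad \min_{x_i,y_i}\ \varphi_i(x_i,y_i;x^{-i})\quad\text{s.t. } x_i\in X_i,\ y_i\in\mathcal{S}(x).$$ Its feasible region is $\Omega_i(x^{-i})=\{(x_i,y_i): x_i\in X_i,\ y_i\in\mathcal{S}(x_i,x^{-i})\}$. Let $\mathcal{F}=\{(x,y): x_i\in X_i,\ y_i\in\mathcal{S}(x)\ \forall i\in\mathcal{N}\}$, with $y=(y_1,\dots,y_N)$. Quasi-potential game: $\mathscr{E}$ is quasi-potential if (i) there exist real-valued functions $\phi_1(x),\dots,\phi_N(x)$ on $X$ and a real-valued function $h$ on $X\times Y$ (the same for all leaders) such that $\varphi_i(x_i,y_i;x^{-i})=\phi_i(x)+h(x,y_i)$ for each $i$; and (ii) there is a function $\pi$ on $X$ such that for all $i$, all $x\in X$ and all $x_i'\in X_i$, $\phi_i(x_i;x^{-i})-\phi_i(x_i';x^{-i})=\pi(x_i;x^{-i})-\pi(x_i';x^{-i})$. $\mathcal{F}^{\rm quasi}=\{(x,w): x_i\in X_i\ \forall i\in\mathcal{N},\ w\in\mathcal{S}(x)\}$. Tangent cone of a set $C\subseteq\mathbb{R}^n$ at $z\in C$: $\mathcal{T}(z;C)=\{dz\in\mathbb{R}^n:\ \exists\ \tau_k>0,\ \tau_k\to0,\ z_k\in C,\ z_k\to z,\ \text{such that } dz=\lim_{k\to\infty}(z_k-z)/\tau_k\}$. B-stationary point of $\mathrm{P}^{\rm quasi}$: a point $(x,w)\in\mathcal{F}^{\rm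 quasi}$ such that $\nabla_x(\pi(x)+h(x,w))^\top dx+\nabla_w h(x,w)^\top dw\ge0$ for all $(dx,dw)\in\mathcal{T}((x,w);\mathcal{F}^{\rm quasi})$. Nash B-stationary point of $\mathscr{E}$: a point $(x,y)\in\mathcal{F}$ such that for all $i\in\mathcal{N}$, $\nabla_i\varphi_i(x_i,y_i;x^{-i})^\top d\ge0$ for all $d\in\mathcal{T}((x_i,y_i);\Omega_i(x^{-i}))$, where $\nabla_i$ denotes the gradient with respect to $(x_i,y_i)$. *)

theory Defs
  imports "HOL-Analysis.Analysis"
begin

text \<open>
  The leaders are the elements of the finite type \<open>'n\<close>.  Their strategy spaces
  \<open>\<real>^m_i\<close> may have different dimensions, so a joint strategy \<open>x = (x_1, \<dots>, x_N)\<close> is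
  a single vector of \<open>\<real>^(m_1 + \<dots> + m_N)\<close>, written \<^typ>\<open>real ^ 'm\<close>, whose coordinate
  \<open>j\<close> belongs to leader \<open>owner E j\<close>; thus \<open>m_i = card {j. owner E j = i}\<close>, and \<open>\<real>^m_i\<close>
  is the subspace of the vectors that vanish outside block \<open>i\<close>.
  The space \<open>Y\<close> is the type \<open>'y\<close>, and \<open>obj E i x u\<close> is the value
  \<open>\<phi>_i(x_i, u; x^{-i})\<close>.
\<close>

record ('m, 'n, 'y) mlmf_game =
  owner :: "'m \<Rightarrow> 'n"
  strat :: "'n \<Rightarrow> (real ^ 'm) set"
  fol_constr :: "real ^ 'm \<Rightarrow> 'y set"
  fol_map :: "real ^ 'm \<Rightarrow> 'y \<Rightarrow> 'y"
  obj :: "'n \<Rightarrow> real ^ 'm \<Rightarrow> 'y \<Rightarrow> real"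

definition leader_space :: "('m::finite, 'n, 'y) mlmf_game \<Rightarrow> 'n \<Rightarrow> (real ^ 'm) set" where
  "leader_space E i = {v. \<forall>j. owner E j \<noteq> i \<longrightarrow> v $ j = 0}"

text \<open>\<open>block E i x\<close> is the component \<open>x_i\<close>, and \<open>replace E i v x\<close> is \<open>(v, x^{-i})\<close>.\<close>

definition block :: "('m::finite, 'n, 'y) mlmf_game \<Rightarrow> 'n \<Rightarrow> real ^ 'm \<Rightarrow> real ^ 'm" where
  "block E i x = (\<chi> j. if owner E j = i then x $ j else 0)"

definition replace ::
    "('m::finite, 'n, 'y) mlmf_game \<Rightarrow> 'n \<Rightarrow> real ^ 'm \<Rightarrow> real ^ 'm \<Rightarrow> real ^ 'm" where
  "replace E i v x = (\<chi> j. if owner E j = i then v $ j else x $ j)"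

definition joint_strat :: "('m::finite, 'n, 'y) mlmf_game \<Rightarrow> (real ^ 'm) set" where
  "joint_strat E = {x. \<forall>i. block E i x \<in> strat E i}"

definition VI_solutions :: "('y::real_inner \<Rightarrow> 'y) \<Rightarrow> 'y set \<Rightarrow> 'y set" where
  "VI_solutions F K = {y \<in> K. \<forall>z\<in>K. F y \<bullet> (z - y) \<ge> 0}"

definition follower_eq ::
    "('m::finite, 'n, 'y::euclidean_space) mlmf_game \<Rightarrow> real ^ 'm \<Rightarrow> 'y set" where
  "follower_eq E x = VI_solutions (fol_map E x) (fol_constr E x)"

text \<open>Continuity of a set-valued map: upper and lower semicontinuity (Berge).\<close>

definition setvalued_continuous_on ::
    "'a::topological_space set \<Rightarrow> ('a \<Rightarrow> 'b::topological_space set) \<Rightarrow> bool" where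
  "setvalued_continuous_on S K \<longleftrightarrow>
     (\<forall>U. open U \<longrightarrow> openin (top_of_set S) {x \<in> S. K x \<subseteq> U}) \<and>
     (\<forall>U. open U \<longrightarrow> openin (top_of_set S) {x \<in> S. K x \<inter> U \<noteq> {}})"

definition is_mlmf_game ::
    "('m::finite, 'n::finite, 'y::euclidean_space) mlmf_game \<Rightarrow> bool" where
  "is_mlmf_game E \<longleftrightarrow>
     (\<forall>i. strat E i \<subseteq> leader_space E i \<and> convex (strat E i) \<and> compact (strat E i)) \<and>
     setvalued_continuous_on (joint_strat E) (fol_constr E) \<and>
     (\<forall>x\<in>joint_strat E. closed (fol_constr E x) \<and> convex (fol_constr E x)) \<and>
     continuous_on (joint_strat E \<times> UNIV) (\<lambda>(x, u). fol_map E x u) \<and>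
     (\<forall>i. continuous_on (joint_strat E \<times> UNIV) (\<lambda>(x, u). obj E i x u))"

text \<open>\<open>leader_feasible E i x\<close> is \<open>\<Omega>_i(x^{-i})\<close>; it does not depend on block \<open>i\<close> of \<open>x\<close>.\<close>

definition leader_feasible ::
    "('m::finite, 'n, 'y::euclidean_space) mlmf_game \<Rightarrow> 'n \<Rightarrow> real ^ 'm \<Rightarrow> ((real ^ 'm) \<times> 'y) set" where
  "leader_feasible E i x =
     {(v, u). v \<in> strat E i \<and> u \<in> follower_eq E (replace E i v x)}"

definition feasible ::
    "('m::finite, 'n, 'y::euclidean_space) mlmf_game \<Rightarrow> ((real ^ 'm) \<times> ('n \<Rightarrow> 'y)) set" where
  "feasible E = {(x, y). \<forall>i. block E i x \<in> strat E i \<and> y i \<in> follower_eq E x}"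

definition feasible_quasi ::
    "('m::finite, 'n, 'y::euclidean_space) mlmf_game \<Rightarrow> ((real ^ 'm) \<times> 'y) set" where
  "feasible_quasi E = {(x, w). (\<forall>i. block E i x \<in> strat E i) \<and> w \<in> follower_eq E x}"

definition quasi_potential ::
    "('m::finite, 'n, 'y::euclidean_space) mlmf_game \<Rightarrow> ('n \<Rightarrow> real ^ 'm \<Rightarrow> real)
      \<Rightarrow> (real ^ 'm \<Rightarrow> 'y \<Rightarrow> real) \<Rightarrow> (real ^ 'm \<Rightarrow> real) \<Rightarrow> bool" where
  "quasi_potential E \<phi> h \<pi> \<longleftrightarrow>
     (\<forall>i. \<forall>x\<in>joint_strat E. \<forall>u. obj E i x u = \<phi> i x + h x u) \<and>
     (\<forall>i. \<forall>x\<in>joint_strat E. \<forall>v\<in>strat E i.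
        \<phi> i x - \<phi> i (replace E i v x) = \<pi> x - \<pi> (replace E i v x))"

definition tangent_cone :: "'a::real_normed_vector \<Rightarrow> 'a set \<Rightarrow> 'a set" where
  "tangent_cone z C = {d. \<exists>\<tau> zs. (\<forall>k::nat. \<tau> k > (0::real)) \<and> \<tau> \<longlonglongrightarrow> 0 \<and>
     (\<forall>k. zs k \<in> C) \<and> zs \<longlonglongrightarrow> z \<and> (\<lambda>k. (zs k - z) /\<^sub>R \<tau> k) \<longlonglongrightarrow> d}"

text \<open>
  The functions of a game are only given on \<open>X \<times> Y\<close>, so gradients are taken within
  the set on which the function is given.  If this set is lower-dimensional the
  gradient is not unique, but its inner product with a tangent direction is
  (lemma \<open>gradient_inner_unique\<close>), and only such inner products are used below.
  As in the informal definitions, stationarity refers to \<open>\<nabla>\<close> without demanding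
  differentiability; for continuously differentiable \<open>\<phi>_i\<close> of a quasi-potential game all
  the gradients involved exist, since \<open>\<pi> + h\<close> has the same partial gradient
  in \<open>(x_i, w)\<close> as \<open>\<phi>_i\<close>.
\<close>

definition has_gradient_within ::
    "('a::real_inner \<Rightarrow> real) \<Rightarrow> 'a \<Rightarrow> 'a \<Rightarrow> 'a set \<Rightarrow> bool" where
  "has_gradient_within f g z S \<longleftrightarrow> (f has_derivative (\<lambda>d. g \<bullet> d)) (at z within S)"

definition gradient_within :: "('a::real_inner \<Rightarrow> real) \<Rightarrow> 'a \<Rightarrow> 'a set \<Rightarrow> 'a" where
  "gradient_within f z S = (SOME g. has_gradient_within f g z S)"

definition C1_on :: "('a::real_inner \<Rightarrow> real) \<Rightarrow> 'a set \<Rightarrow> bool" where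
  "C1_on f S \<longleftrightarrow> (\<exists>g. continuous_on S g \<and> (\<forall>z\<in>S. has_gradient_within f (g z) z S))"

lemma gradient_inner_unique:
  assumes "has_gradient_within f g z S" "has_gradient_within f g' z S"
    and "C \<subseteq> S" "d \<in> tangent_cone z C"
  shows "g \<bullet> d = g' \<bullet> d"
proof -
  obtain \<tau> :: "nat \<Rightarrow> real" and zs where \<tau>: "\<And>k. \<tau> k > 0"
    and zs: "\<And>k. zs k \<in> S" "zs \<longlonglongrightarrow> z" and lim: "(\<lambda>k. (zs k - z) /\<^sub>R \<tau> k) \<longlonglongrightarrow> d"
    using assms(3,4) unfolding tangent_cone_def by blast
  let ?G = "\<lambda>v. (g - g') \<bullet> v"
  have "((\<lambda>v. f v - f v) has_derivative ?G) (at z within S)"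
    using has_derivative_diff[OF assms(1,2)[unfolded has_gradient_within_def]]
    by (simp add: inner_diff_left)
  then have D: "\<exists>\<delta>>0. \<forall>y\<in>S. norm (y - z) < \<delta> \<longrightarrow> norm (?G (y - z)) \<le> e * norm (y - z)"
    if "e > 0" for e
    using that by (simp add: has_derivative_within_alt)
  have le: "\<bar>?G d\<bar> \<le> e * norm d" if e: "e > 0" for e
  proof -
    obtain \<delta> where \<delta>: "\<delta> > 0"
      "\<And>y. y \<in> S \<Longrightarrow> norm (y - z) < \<delta> \<Longrightarrow> norm (?G (y - z)) \<le> e * norm (y - z)"
      using D[OF e] by blast
    have "\<forall>\<^sub>F k in sequentially. norm (zs k - z) < \<delta>"
      using tendstoD[OF zs(2) \<delta>(1)] by (simp add: dist_norm)
    then have ev: "\<forall>\<^sub>F k in sequentially.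
        \<bar>?G ((zs k - z) /\<^sub>R \<tau> k)\<bar> \<le> e * norm ((zs k - z) /\<^sub>R \<tau> k)"
    proof eventually_elim
      case (elim k)
      then have "\<bar>?G (zs k - z)\<bar> \<le> e * norm (zs k - z)"
        using \<delta>(2)[OF zs(1)] by simp
      then show ?case
        using \<tau>[of k] by (simp add: abs_mult divide_simps)
    qed
    show ?thesis
      by (rule tendsto_le[OF sequentially_bot
            tendsto_mult[OF tendsto_const tendsto_norm[OF lim]]
            tendsto_rabs[OF tendsto_inner[OF tendsto_const lim]] ev])
  qed
  have "\<bar>?G d\<bar> \<le> 0"
  proof (rule field_le_epsilon)
    fix e :: real assume "e > 0"
    then have "\<bar>?G d\<bar> \<le> e / (norm d + 1) * norm d"
      by (intro le) (simp add: add_nonneg_pos)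
    also have "\<dots> \<le> e"
      using \<open>e > 0\<close> by (simp add: divide_simps add_nonneg_pos)
    finally show "\<bar>?G d\<bar> \<le> 0 + e" by simp
  qed
  then show ?thesis by (simp add: inner_diff_left)
qed

definition B_stationary_quasi ::
    "('m::finite, 'n, 'y::euclidean_space) mlmf_game \<Rightarrow> (real ^ 'm \<Rightarrow> 'y \<Rightarrow> real)
      \<Rightarrow> (real ^ 'm \<Rightarrow> real) \<Rightarrow> real ^ 'm \<Rightarrow> 'y \<Rightarrow> bool" where
  "B_stationary_quasi E h \<pi> x w \<longleftrightarrow>
     (x, w) \<in> feasible_quasi E \<and>
     (\<forall>(dx, dw) \<in> tangent_cone (x, w) (feasible_quasi E).
        gradient_within (\<lambda>x'. \<pi> x' + h x' w) x (joint_strat E) \<bullet> dx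
        + gradient_within (\<lambda>w'. h x w') w UNIV \<bullet> dw \<ge> 0)"

definition nash_B_stationary ::
    "('m::finite, 'n, 'y::euclidean_space) mlmf_game \<Rightarrow> real ^ 'm \<Rightarrow> ('n \<Rightarrow> 'y) \<Rightarrow> bool" where
  "nash_B_stationary E x y \<longleftrightarrow>
     (x, y) \<in> feasible E \<and>
     (\<forall>i. \<forall>d \<in> tangent_cone (block E i x, y i) (leader_feasible E i x).
        gradient_within (\<lambda>(v, u). obj E i (replace E i v x) u)
          (block E i x, y i) (strat E i \<times> UNIV) \<bullet> d \<ge> 0)"

end

theory Submission
  imports Defs
begin

text \<open>
  A feasible move of leader \<open>i\<close>, with \<open>x^{-i}\<close> kept fixed, is also a feasible move in the
  common problem, because both problems impose the same condition \<open>w \<in> S(x)\<close>.  Hence a direction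
  \<open>(v, u)\<close> that is tangent to \<open>\<Omega>_i(x^{-i})\<close> gives a direction \<open>(v, u)\<close>, with zero entries in the
  other blocks, that is tangent to the feasible set of the common problem
  (\<open>tangent_cone_map\<close>).  Along such directions \<open>\<pi> + h\<close> and \<open>\<phi>_i\<close> have the same first-order
  change: on the block of leader \<open>i\<close> their increments agree, since \<open>\<pi>\<close> is a potential
  for the functions \<open>\<phi>_i - h\<close>, and as functions of \<open>w\<close> they differ by a constant.
  B-stationarity for \<open>\<pi> + h\<close> is therefore B-stationarity for every \<open>\<phi>_i\<close>.

  The comparison needs the gradient of \<open>\<pi> + h(\<cdot>, w)\<close> to exist, which is not assumed: neither \<open>\<pi>\<close>
  nor \<open>h(\<cdot>, w)\<close> need be differentiable by itself.  What the hypotheses provide are continuous partial gradients, one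
  for each block, inherited from the functions \<open>\<phi>_i\<close>.  As in the classical theorem on continuous
  partial derivatives, they add up to a total gradient within the convex product \<open>X\<close>
  (\<open>has_gradient_within_joint_strat\<close>).  The set \<open>X\<close> may have empty interior,
  so gradients are determined only on tangent directions; that suffices, by
  \<open>gradient_inner_unique\<close>.
\<close>

section \<open>Blocks of a joint strategy\<close>

lemma bounded_linear_block: "bounded_linear (block E i)"
  unfolding linear_conv_bounded_linear[symmetric]
  by (rule linearI) (simp_all add: block_def vec_eq_iff)

lemma inner_block_left: "block E i a \<bullet> b = a \<bullet> block E i b"
  by (auto simp: inner_vec_def block_def intro!: sum.cong)

lemma block_block: "block E j (block E i v) = (if j = i then block E i v else 0)"
  by (auto simp: block_def vec_eq_iff)

lemma norm_block_le: "norm (block E i v) \<le> norm v"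
  by (rule norm_le_componentwise_cart) (simp add: block_def)

lemma block_eq_self: "v \<in> leader_space E i \<Longrightarrow> block E i v = v"
  by (auto simp: block_def leader_space_def vec_eq_iff)

lemma replace_block: "replace E i (block E i y) z = replace E i y z"
  by (simp add: replace_def block_def vec_eq_iff)

lemma replace_self: "replace E i x x = x"
  by (simp add: replace_def vec_eq_iff)

lemma replace_diff: "replace E i v x - replace E i v' x = block E i (v - v')"
  by (simp add: replace_def block_def vec_eq_iff)

lemma block_replace: "block E j (replace E i v x) = (if j = i then block E i v else block E j x)"
  by (auto simp: replace_def block_def vec_eq_iff)

lemma replace_in_joint_strat:
  assumes "strat E i \<subseteq> leader_space E i" "x \<in> joint_strat E" "v \<in> strat E i"
  shows "replace E i v x \<in> joint_strat E"
  using assms block_eq_self[of v E i] by (auto simp: joint_strat_def block_replace)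

lemma convex_joint_strat:
  assumes "\<And>i. convex (strat E i)"
  shows "convex (joint_strat E)"
proof -
  have "joint_strat E = (\<Inter>i. block E i -` strat E i)"
    by (auto simp: joint_strat_def)
  then show ?thesis
    using assms bounded_linear_block
    by (auto intro!: convex_INT convex_linear_vimage bounded_linear.linear)
qed

section \<open>Total gradients from block gradients\<close>

text \<open>Interpolates between \<open>x\<close> and \<open>y\<close> while the leaders in \<open>I\<close> switch to \<open>y\<close>, so
  that the increment of a function from \<open>x\<close> to \<open>y\<close> telescopes into moves of one leader each.\<close>

definition switch_blocks ::
    "('m::finite, 'n, 'y) mlmf_game \<Rightarrow> 'n set \<Rightarrow> real ^ 'm \<Rightarrow> real ^ 'm \<Rightarrow> real ^ 'm" where
  "switch_blocks E I y x = (\<chi> j. if owner E j \<in> I then y $ j else x $ j)"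

lemma switch_blocks_empty: "switch_blocks E {} y x = x"
  by (simp add: switch_blocks_def vec_eq_iff)

lemma switch_blocks_UNIV: "switch_blocks E UNIV y x = y"
  by (simp add: switch_blocks_def vec_eq_iff)

lemma switch_blocks_insert:
  "switch_blocks E (insert i I) y x = replace E i y (switch_blocks E I y x)"
  by (auto simp: switch_blocks_def replace_def vec_eq_iff)

lemma switch_blocks_insert_diff:
  "i \<notin> I \<Longrightarrow> switch_blocks E (insert i I) y x - switch_blocks E I y x = block E i (y - x)"
  by (auto simp: switch_blocks_def block_def vec_eq_iff)

lemma norm_switch_blocks_le: "norm (switch_blocks E I y x - x) \<le> norm (y - x)"
  by (rule norm_le_componentwise_cart) (simp add: switch_blocks_def)

lemma switch_blocks_in_joint_strat:
  assumes "x \<in> joint_strat E" "y \<in> joint_strat E"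
  shows "switch_blocks E I y x \<in> joint_strat E"
proof -
  have "block E i (switch_blocks E I y x) = (if i \<in> I then block E i y else block E i x)" for i
    by (auto simp: switch_blocks_def block_def vec_eq_iff)
  then show ?thesis
    using assms by (simp add: joint_strat_def)
qed

lemma onorm_inner_diff_le: "onorm ((\<bullet>) a - (\<bullet>) b) \<le> norm (a - b)"
proof (rule onorm_bound)
  fix d
  show "norm (((\<bullet>) a - (\<bullet>) b) d) \<le> norm (a - b) * norm d"
    using Cauchy_Schwarz_ineq2[of "a - b" d] by (simp add: inner_diff_left)
qed simp

text \<open>Continuous gradients make the linearization at \<open>x\<close> uniformly good near \<open>x\<close>, also for
  increments that do not start at \<open>x\<close>; the telescoping sum needs this stronger form.\<close>

lemma C1_uniform_linearization:
  fixes F :: "'a::real_inner \<Rightarrow> real"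
  assumes "convex S" "x \<in> S" "continuous_on S g"
    and grad: "\<And>z. z \<in> S \<Longrightarrow> has_gradient_within F (g z) z S"
    and "e > 0"
  obtains \<delta> where "\<delta> > 0"
    "\<And>a b. a \<in> S \<inter> ball x \<delta> \<Longrightarrow> b \<in> S \<inter> ball x \<delta> \<Longrightarrow>
       \<bar>F b - F a - g x \<bullet> (b - a)\<bar> \<le> e * norm (b - a)"
proof -
  obtain \<delta> where \<delta>: "\<delta> > 0" "\<And>z. z \<in> S \<Longrightarrow> dist z x < \<delta> \<Longrightarrow> dist (g z) (g x) < e"
    using assms(2,3,5) unfolding continuous_on_iff by metis
  let ?B = "S \<inter> ball x \<delta>"
  have "\<bar>F b - F a - g x \<bullet> (b - a)\<bar> \<le> e * norm (b - a)" if ab: "a \<in> ?B" "b \<in> ?B" for a b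
  proof -
    have "convex ?B"
      using assms(1) by (simp add: convex_Int)
    then have seg: "a + t *\<^sub>R (b - a) \<in> ?B" if "t \<in> {0..1}" for t
      using that ab convexD_alt[of ?B a b t] by (simp add: algebra_simps)
    have der: "(F has_derivative (\<lambda>d. g z \<bullet> d)) (at z within ?B)" if "z \<in> ?B" for z
      using grad[of z] that has_derivative_subset unfolding has_gradient_within_def by blast
    have bnd: "onorm ((\<bullet>) (g z) - (\<bullet>) (g x)) \<le> e" if "z \<in> ?B" for z
      using onorm_inner_diff_le[of "g z" "g x"] \<delta>(2)[of z] that
      by (force simp: dist_norm dist_commute norm_minus_commute)
    have "norm (F b - F a - g x \<bullet> (b - a)) \<le> norm (b - a) * e"
      by (rule differentiable_bound_linearization[where S = ?B and f' = "\<lambda>z. (\<bullet>) (g z)"])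
        (use seg der bnd assms(2) \<delta>(1) in auto)
    then show ?thesis by (simp add: mult.commute)
  qed
  with \<delta>(1) that show thesis by blast
qed

text \<open>The functions \<open>F i\<close> only share with \<open>f\<close> the increments of leader \<open>i\<close>; they carry
  its partial gradients although \<open>f\<close> itself is not known to be differentiable.\<close>

lemma has_gradient_within_joint_strat:
  fixes E :: "('m::finite, 'n::finite, 'y) mlmf_game" and f :: "real ^ 'm \<Rightarrow> real"
  assumes conv: "convex (joint_strat E)" and x: "x \<in> joint_strat E"
    and cont: "\<And>i. continuous_on (joint_strat E) (g i)"
    and grad: "\<And>i z. z \<in> joint_strat E \<Longrightarrow> has_gradient_within (F i) (g i z) z (joint_strat E)"
    and incr: "\<And>i z v. z \<in> joint_strat E \<Longrightarrow> v \<in> strat E i \<Longrightarrow>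
      f (replace E i v z) - f z = F i (replace E i v z) - F i z"
  shows "has_gradient_within f (\<Sum>i\<in>UNIV. block E i (g i x)) x (joint_strat E)"
  unfolding has_gradient_within_def has_derivative_within_alt
proof (intro conjI allI impI)
  show "bounded_linear (\<lambda>d. (\<Sum>i\<in>UNIV. block E i (g i x)) \<bullet> d)"
    by (rule bounded_linear_inner_right)
next
  let ?X = "joint_strat E"
  fix e :: real assume "e > 0"
  define e' where "e' = e / real CARD('n)"
  have "e' > 0" using \<open>e > 0\<close> by (simp add: e'_def)
  have "\<exists>\<delta>>0. \<forall>a\<in>?X \<inter> ball x \<delta>. \<forall>b\<in>?X \<inter> ball x \<delta>.
      \<bar>F i b - F i a - g i x \<bullet> (b - a)\<bar> \<le> e' * norm (b - a)" for i
    using C1_uniform_linearization[OF conv x cont grad \<open>e' > 0\<close>, of i] by metis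
  then obtain D where D: "\<And>i. D i > 0"
    "\<And>i a b. a \<in> ?X \<inter> ball x (D i) \<Longrightarrow> b \<in> ?X \<inter> ball x (D i) \<Longrightarrow>
      \<bar>F i b - F i a - g i x \<bullet> (b - a)\<bar> \<le> e' * norm (b - a)"
    by metis
  define \<delta> where "\<delta> = Min (range D)"
  have \<delta>: "\<delta> > 0" "\<And>i. \<delta> \<le> D i"
    using D(1) by (auto simp: \<delta>_def)
  have "\<bar>f y - f x - (\<Sum>i\<in>UNIV. block E i (g i x)) \<bullet> (y - x)\<bar> \<le> e * norm (y - x)"
    if y: "y \<in> ?X" "norm (y - x) < \<delta>" for y
  proof -
    let ?s = "\<lambda>I. switch_blocks E I y x"
    have near: "?s I \<in> ?X \<inter> ball x (D i)" for I i
      using switch_blocks_in_joint_strat[OF x y(1)] norm_switch_blocks_le[of E I y x] y(2) \<delta>(2)[of i]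
      by (simp add: dist_norm norm_minus_commute)
    have "\<bar>f (?s I) - f x - (\<Sum>i\<in>I. block E i (g i x)) \<bullet> (y - x)\<bar>
        \<le> real (card I) * (e' * norm (y - x))" for I
      using finite[of I]
    proof (induction I rule: finite_induct)
      case empty
      show ?case by (simp add: switch_blocks_empty)
    next
      case (insert i I)
      have "block E i y \<in> strat E i"
        using y(1) by (simp add: joint_strat_def)
      then have "f (?s (insert i I)) - f (?s I) = F i (?s (insert i I)) - F i (?s I)"
        using incr[of "?s I" "block E i y" i] near[of I i]
        by (simp add: switch_blocks_insert replace_block)
      moreover have "\<bar>F i (?s (insert i I)) - F i (?s I) - g i x \<bullet> block E i (y - x)\<bar>
          \<le> e' * norm (block E i (y - x))"
        using D(2)[OF near near, of i "insert i I" I]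
        by (simp only: switch_blocks_insert_diff[OF insert.hyps(2)])
      moreover have "e' * norm (block E i (y - x)) \<le> e' * norm (y - x)"
        using norm_block_le \<open>e' > 0\<close> by (simp add: mult_left_mono)
      ultimately have "\<bar>f (?s (insert i I)) - f (?s I) - block E i (g i x) \<bullet> (y - x)\<bar>
          \<le> e' * norm (y - x)"
        by (simp add: inner_block_left)
      then show ?case
        using insert.IH insert.hyps by (simp add: inner_add_left distrib_right)
    qed
    from this[of UNIV] show ?thesis
      by (simp add: switch_blocks_UNIV e'_def)
  qed
  then show "\<exists>\<delta>>0. \<forall>y\<in>?X. norm (y - x) < \<delta> \<longrightarrow>
      norm (f y - f x - (\<Sum>i\<in>UNIV. block E i (g i x)) \<bullet> (y - x)) \<le> e * norm (y - x)"
    using \<delta>(1) by auto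
qed

section \<open>Gradients and tangent directions\<close>

lemma gradient_within_inner:
  assumes "has_gradient_within f g z S" "C \<subseteq> S" "d \<in> tangent_cone z C"
  shows "gradient_within f z S \<bullet> d = g \<bullet> d"
proof -
  have "has_gradient_within f (gradient_within f z S) z S"
    unfolding gradient_within_def using assms(1) by (rule someI)
  then show ?thesis
    using gradient_inner_unique assms by blast
qed

lemma gradient_within_UNIV:
  assumes "has_gradient_within f g z UNIV"
  shows "gradient_within f z UNIV = g"
proof -
  have "has_gradient_within f (gradient_within f z UNIV) z UNIV"
    unfolding gradient_within_def using assms by (rule someI)
  then have "(\<lambda>d. gradient_within f z UNIV \<bullet> d) = (\<lambda>d. g \<bullet> d)"
    using assms has_derivative_unique unfolding has_gradient_within_def by blast
  then show ?thesis
    by (metis inner_commute vector_eq_ldot)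
qed

text \<open>Chain rule for a map that is affine with linear part \<open>L\<close>; the relation between \<open>g\<close> and
  \<open>g'\<close> says that \<open>g'\<close> is the image of \<open>g\<close> under the adjoint of \<open>L\<close>.\<close>

lemma has_gradient_within_affine_compose:
  assumes "has_gradient_within f g (T z) S" "bounded_linear L"
    and "\<And>p. T p - T z = L (p - z)" "T ` S' \<subseteq> S"
    and "\<And>d. g \<bullet> L d = g' \<bullet> d"
  shows "has_gradient_within (\<lambda>p. f (T p)) g' z S'"
proof -
  have "T = (\<lambda>p. L p + (T z - L z))"
  proof
    fix p
    have "T p - T z = L p - L z"
      using assms(3)[of p] by (simp add: linear_diff[OF bounded_linear.linear[OF assms(2)]])
    then show "T p = L p + (T z - L z)" by (simp add: algebra_simps)
  qed
  then have "(T has_derivative L) (at z within S')"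
    using has_derivative_add[OF bounded_linear_imp_has_derivative[OF assms(2)] has_derivative_const]
    by (metis (no_types, lifting) add.right_neutral ext)
  then have "((\<lambda>p. f (T p)) has_derivative (\<lambda>d. g \<bullet> L d)) (at z within S')"
    using assms(1,4) unfolding has_gradient_within_def
    by (metis has_derivative_in_compose has_derivative_subset)
  then show ?thesis
    using assms(5) by (simp add: has_gradient_within_def)
qed

lemma tangent_cone_map:
  assumes "d \<in> tangent_cone z C" "bounded_linear L"
    and "\<And>p. T p - T z = L (p - z)" "T ` C \<subseteq> D"
  shows "L d \<in> tangent_cone (T z) D"
proof -
  interpret L: bounded_linear L by fact
  obtain \<tau> :: "nat \<Rightarrow> real" and zs where *: "\<And>k. \<tau> k > 0" "\<tau> \<longlonglongrightarrow> 0"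
    "\<And>k. zs k \<in> C" "zs \<longlonglongrightarrow> z" "(\<lambda>k. (zs k - z) /\<^sub>R \<tau> k) \<longlonglongrightarrow> d"
    using assms(1) unfolding tangent_cone_def by blast
  have "(\<lambda>k. L (zs k - z)) \<longlonglongrightarrow> 0"
    using L.tendsto[OF LIM_zero[OF *(4)]] by (simp add: L.zero)
  then have "(\<lambda>k. T (zs k)) \<longlonglongrightarrow> T z"
    using assms(3) by (auto intro: LIM_zero_cancel)
  moreover have "(\<lambda>k. (T (zs k) - T z) /\<^sub>R \<tau> k) \<longlonglongrightarrow> L d"
    using L.tendsto[OF *(5)] by (simp add: assms(3) L.scaleR)
  ultimately show ?thesis
    using * assms(4) unfolding tangent_cone_def
    by (intro CollectI exI[of _ \<tau>] exI[of _ "\<lambda>k. T (zs k)"]) auto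
qed

section \<open>Stationarity of the common problem and of the game\<close>

theorem mainTheorem4:
  fixes E :: "('m::finite, 'n::finite, 'y::euclidean_space) mlmf_game"
    and \<phi> :: "'n \<Rightarrow> real ^ 'm \<Rightarrow> real"
    and h :: "real ^ 'm \<Rightarrow> 'y \<Rightarrow> real"
    and \<pi> :: "real ^ 'm \<Rightarrow> real"
    and x :: "real ^ 'm" and w :: 'y
  assumes "is_mlmf_game E"
    and "quasi_potential E \<phi> h \<pi>"
    and "\<And>i. C1_on (\<lambda>(x', u). obj E i x' u) (joint_strat E \<times> UNIV)"
    and "B_stationary_quasi E h \<pi> x w"
  shows "nash_B_stationary E x (\<lambda>i. w)"
proof -
  let ?X = "joint_strat E"
  have sub: "\<And>i. strat E i \<subseteq> leader_space E i" and conv: "convex ?X"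
    using assms(1) by (auto simp: is_mlmf_game_def intro: convex_joint_strat)
  have obj: "\<And>i x u. x \<in> ?X \<Longrightarrow> obj E i x u = \<phi> i x + h x u"
    and pot: "\<And>i x v. x \<in> ?X \<Longrightarrow> v \<in> strat E i \<Longrightarrow>
      \<phi> i x - \<phi> i (replace E i v x) = \<pi> x - \<pi> (replace E i v x)"
    using assms(2) by (auto simp: quasi_potential_def)
  have feas: "(x, w) \<in> feasible_quasi E"
    and stat: "\<And>dx dw. (dx, dw) \<in> tangent_cone (x, w) (feasible_quasi E) \<Longrightarrow>
      gradient_within (\<lambda>x'. \<pi> x' + h x' w) x ?X \<bullet> dx
        + gradient_within (\<lambda>w'. h x w') w UNIV \<bullet> dw \<ge> 0"
    using assms(4) by (auto simp: B_stationary_quasi_def)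
  have x: "x \<in> ?X"
    using feas by (auto simp: feasible_quasi_def joint_strat_def)
  obtain g where g: "\<And>i. continuous_on (?X \<times> UNIV) (g i)"
    "\<And>i z. z \<in> ?X \<times> UNIV \<Longrightarrow>
      has_gradient_within (\<lambda>(x', u). obj E i x' u) (g i z) z (?X \<times> UNIV)"
    using assms(3) unfolding C1_on_def by metis

  have grad_x: "has_gradient_within (\<lambda>x'. \<pi> x' + h x' w)
      (\<Sum>i\<in>UNIV. block E i (fst (g i (x, w)))) x ?X"
  proof (rule has_gradient_within_joint_strat[where F = "\<lambda>i x'. obj E i x' w"
        and g = "\<lambda>i x'. fst (g i (x', w))", OF conv x])
    show "continuous_on ?X (\<lambda>x'. fst (g i (x', w)))" for i
      by (intro continuous_on_fst continuous_on_compose2[OF g(1)] continuous_intros) auto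
    show "has_gradient_within (\<lambda>x'. obj E i x' w) (fst (g i (z, w))) z ?X" if "z \<in> ?X" for i z
    proof -
      have "has_gradient_within (\<lambda>p. (\<lambda>(x', u). obj E i x' u) (p, w)) (fst (g i (z, w))) z ?X"
        by (rule has_gradient_within_affine_compose[where L = "\<lambda>d. (d, 0)" and S = "?X \<times> UNIV"])
          (use g(2)[of "(z, w)" i] that in
            \<open>auto simp: inner_prod_def intro!: bounded_linear_intros\<close>)
      then show ?thesis by simp
    qed
    show "\<pi> (replace E i v z) + h (replace E i v z) w - (\<pi> z + h z w)
        = obj E i (replace E i v z) w - obj E i z w"
      if "z \<in> ?X" "v \<in> strat E i" for i z v
      using pot[OF that] obj[OF that(1)] obj[OF replace_in_joint_strat[OF sub that]] by simp
  qed

  have "gradient_within (\<lambda>(v, u). obj E i (replace E i v x) u)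
      (block E i x, w) (strat E i \<times> UNIV) \<bullet> d \<ge> 0"
    if d: "d \<in> tangent_cone (block E i x, w) (leader_feasible E i x)" for i d
  proof -
    obtain dv du where d_eq: "d = (dv, du)" by (cases d)
    let ?T = "\<lambda>p :: (real ^ 'm) \<times> 'y. (replace E i (fst p) x, snd p)"
    let ?L = "\<lambda>p :: (real ^ 'm) \<times> 'y. (block E i (fst p), snd p)"
    let ?z = "(block E i x, w)"
    have Tz: "?T ?z = (x, w)"
      by (simp add: replace_block replace_self)
    have L: "bounded_linear ?L"
      by (intro bounded_linear_Pair bounded_linear_compose[OF bounded_linear_block]
          bounded_linear_fst bounded_linear_snd)
    have TL: "?T p - ?T ?z = ?L (p - ?z)" for p
      using replace_diff[of E i "fst p" x "block E i x"] by simp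
    have feas_sub: "?T ` leader_feasible E i x \<subseteq> feasible_quasi E"
      using replace_in_joint_strat[OF sub x]
      by (fastforce simp: leader_feasible_def feasible_quasi_def joint_strat_def)
    have tan: "(block E i dv, du) \<in> tangent_cone (x, w) (feasible_quasi E)"
      using tangent_cone_map[where T = ?T and L = ?L, OF d L TL feas_sub]
      unfolding Tz by (simp add: d_eq)
    have tan_x: "block E i dv \<in> tangent_cone x ?X"
      using tangent_cone_map[OF tan bounded_linear_fst, of fst ?X]
      by (force simp: feasible_quasi_def joint_strat_def)

    have "gradient_within (\<lambda>x'. \<pi> x' + h x' w) x ?X \<bullet> block E i dv
        = (\<Sum>j\<in>UNIV. block E j (fst (g j (x, w)))) \<bullet> block E i dv"
      by (rule gradient_within_inner[OF grad_x subset_refl tan_x])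
    also have "\<dots> = (\<Sum>j\<in>UNIV. if j = i then fst (g i (x, w)) \<bullet> block E i dv else 0)"
      unfolding inner_sum_left by (intro sum.cong) (auto simp: inner_block_left block_block)
    also have "\<dots> = fst (g i (x, w)) \<bullet> block E i dv"
      by simp
    finally have eq_x: "gradient_within (\<lambda>x'. \<pi> x' + h x' w) x ?X \<bullet> block E i dv
        = fst (g i (x, w)) \<bullet> block E i dv" .

    have "has_gradient_within (\<lambda>u. (\<lambda>(x', u). obj E i x' u) (x, u)) (snd (g i (x, w))) w UNIV"
      by (rule has_gradient_within_affine_compose[where L = "\<lambda>d. (0, d)" and S = "?X \<times> UNIV"])
        (use g(2)[of "(x, w)" i] x in \<open>auto simp: inner_prod_def intro!: bounded_linear_intros\<close>)
    then have "((\<lambda>u. \<phi> i x + h x u - \<phi> i x) has_derivative (\<lambda>d. snd (g i (x, w)) \<bullet> d - 0)) (at w)"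
      unfolding has_gradient_within_def
      by (intro has_derivative_diff has_derivative_const) (simp add: obj[OF x])
    then have "has_gradient_within (\<lambda>u. h x u) (snd (g i (x, w))) w UNIV"
      by (simp add: has_gradient_within_def)
    then have eq_w: "gradient_within (\<lambda>u. h x u) w UNIV = snd (g i (x, w))"
      by (rule gradient_within_UNIV)

    have "has_gradient_within (\<lambda>p. (\<lambda>(x', u). obj E i x' u) (?T p))
        (block E i (fst (g i (x, w))), snd (g i (x, w))) ?z (strat E i \<times> UNIV)"
    proof (rule has_gradient_within_affine_compose[where T = ?T and L = ?L, OF _ L TL])
      show "has_gradient_within (\<lambda>(x', u). obj E i x' u) (g i (x, w)) (?T ?z) (?X \<times> UNIV)"
        unfolding Tz using g(2) x by simp
      show "?T ` (strat E i \<times> UNIV) \<subseteq> ?X \<times> UNIV"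
        using replace_in_joint_strat[OF sub x] by auto
      show "g i (x, w) \<bullet> ?L d = (block E i (fst (g i (x, w))), snd (g i (x, w))) \<bullet> d" for d
        by (simp add: inner_prod_def inner_block_left)
    qed
    then have "has_gradient_within (\<lambda>(v, u). obj E i (replace E i v x) u)
        (block E i (fst (g i (x, w))), snd (g i (x, w))) ?z (strat E i \<times> UNIV)"
      by (simp add: case_prod_unfold)
    then have "gradient_within (\<lambda>(v, u). obj E i (replace E i v x) u) ?z (strat E i \<times> UNIV) \<bullet> d
        = (block E i (fst (g i (x, w))), snd (g i (x, w))) \<bullet> d"
      by (rule gradient_within_inner[OF _ _ d]) (auto simp: leader_feasible_def)
    also have "\<dots> = fst (g i (x, w)) \<bullet> block E i dv + snd (g i (x, w)) \<bullet> du"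
      by (simp add: d_eq inner_block_left)
    also have "\<dots> \<ge> 0"
      using stat[OF tan] by (simp add: eq_x eq_w)
    finally show ?thesis .
  qed
  then show ?thesis
    using feas by (auto simp: nash_B_stationary_def feasible_def feasible_quasi_def)
qed

end
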